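(* Let $\mu\prec_{\mathcal{F}}\nu$ be two Radon probability measures on $\Omega$. Then there exists the minimal closed set $S\subset\Omega\times\Omega$ such that $\pi(S)=1$ for every $\pi\in\Gamma_{\mathcal{F}}(\mu,\nu)$; that is, there is a closed set $S$ with this property which is contained in every closed set with this property.
   Context: $\Omega$ is a set and $\mathcal{G}$ is a convex cone of real-valued functions on $\Omega$ that contains the constants and separates points. $\tau(\mathcal{G})$ is the coarsest topology on $\Omega$ making all elements of $\mathcal{G}$ continuous; all topological and Borel notions on $\Omega$ refer to it, and $\Omega\times\Omega$ has the product topology. $\mathcal{F}$ is the lattice cone generated by $\mathcal{G}$ (all maxima of finite non-empty families in $\mathcal{G}$), $\mathcal{H}$ the complete lattice cone generated by $\mathcal{G}$ (all suprema of families in $\mathcal{G}$). A function $p\colon\Omega\to[0,\infty)$ in $\mathcal{H}$ is fixed which is proper (preimages of compact subsets of $\mathbb{R}$ are compact) and such that for each $g\in\mathcal{G}$ there is $C>0$ with $|g|\le C(p+1)$; $p$ is integrable with respect to $\mu$ and $\nu$. A Borel measure $m$ is Radon if for every Borel $B$ and $\epsilon>0$ there is a compact $K\subset B$ with $|m|(B\setminus K)<\epsilon$. $\mu\prec_{\mathcal{F}}\nu$ means $\int f\,d\mu\le\int f\,d\nu$ for all $f\in\mathcal{F}$. $\Gamma_{\mathcal{F}}(\mu,\nu)$ is the set of Radon probability measures $\pi$ on $\Omega\times\Omega$ with marginals $\mu,\nu$ such that $\int f(\omega_1)h(\omega_1)\,d\mu(\omega_1)\le\int f(\omega_2)h(\omega_1)\,d\pi(\omega_1,\omega_2)$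 for all $f\in\mathcal{F}$ and all bounded non-negative measurable $h$. *)

theory Defs
  imports "HOL-Probability.Probability"
begin

(* The ground set Omega is the whole type 'a, so that real-valued functions on Omega are
   exactly the elements of 'a => real.  Its topology depends on the cone and is therefore an
   abstract topology, unrelated to any type class instance on 'a. *)

(* Functions carry no real_vector instance in the library, so the library constant convex_cone
   does not apply and the algebraic conditions are written pointwise. *)
definition fun_convex_cone :: "('a \<Rightarrow> real) set \<Rightarrow> bool" where
  "fun_convex_cone G \<longleftrightarrow>
     G \<noteq> {} \<and>
     (\<forall>f\<in>G. \<forall>g\<in>G. (\<lambda>x. f x + g x) \<in> G) \<and>
     (\<forall>c::real. \<forall>f\<in>G. 0 \<le> c \<longrightarrow> (\<lambda>x. c * f x) \<in> G)"

definition contains_constants :: "('a \<Rightarrow> real) set \<Rightarrow> bool" where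
  "contains_constants G \<longleftrightarrow> (\<forall>c::real. (\<lambda>_. c) \<in> G)"

definition separates_points :: "('a \<Rightarrow> real) set \<Rightarrow> bool" where
  "separates_points G \<longleftrightarrow> (\<forall>x y. x \<noteq> y \<longrightarrow> (\<exists>g\<in>G. g x \<noteq> g y))"

(* Its carrier is the union of the generating sets; this is all of 'a as soon as G is nonempty. *)
definition tau :: "('a \<Rightarrow> real) set \<Rightarrow> 'a topology" where
  "tau G = topology_generated_by {g -` U | g U. g \<in> G \<and> open U}"

definition borel_of :: "'a topology \<Rightarrow> 'a measure" where
  "borel_of T = sigma (topspace T) {U. openin T U}"

definition lattice_cone :: "('a \<Rightarrow> real) set \<Rightarrow> ('a \<Rightarrow> real) set" where
  "lattice_cone G = {(\<lambda>x. Max ((\<lambda>g. g x) ` A)) | A. finite A \<and> A \<noteq> {} \<and> A \<subseteq> G}"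

(* Suprema of infinite families may take the value infinity, hence the extended reals. *)
definition complete_lattice_cone :: "('a \<Rightarrow> real) set \<Rightarrow> ('a \<Rightarrow> ereal) set" where
  "complete_lattice_cone G = {(\<lambda>x. SUP g\<in>A. ereal (g x)) | A. A \<noteq> {} \<and> A \<subseteq> G}"

(* The library's proper_map asks for a closed map with compact fibres; here p is only asked to
   have compact preimages of compact sets. *)
definition proper_fun :: "'a topology \<Rightarrow> ('a \<Rightarrow> real) \<Rightarrow> bool" where
  "proper_fun T p \<longleftrightarrow> (\<forall>K. compact K \<longrightarrow> compactin T (p -` K))"

(* For nonnegative measures the total variation |M| is M itself.  Measurability of K is automatic
   in Hausdorff spaces; it is required explicitly because emeasure is 0 on non-measurable sets. *)
definition radon_measure :: "'a topology \<Rightarrow> 'a measure \<Rightarrow> bool" where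
  "radon_measure T M \<longleftrightarrow>
     sets M = sets (borel_of T) \<and>
     (\<forall>B\<in>sets M. \<forall>e::real. 0 < e \<longrightarrow>
        (\<exists>K\<in>sets M. compactin T K \<and> K \<subseteq> B \<and> emeasure M (B - K) < ennreal e))"

definition radon_prob :: "'a topology \<Rightarrow> 'a measure \<Rightarrow> bool" where
  "radon_prob T M \<longleftrightarrow> prob_space M \<and> radon_measure T M"

definition order_le :: "('a \<Rightarrow> real) set \<Rightarrow> 'a measure \<Rightarrow> 'a measure \<Rightarrow> bool" where
  "order_le F \<mu> \<nu> \<longleftrightarrow> (\<forall>f\<in>F. (\<integral>x. f x \<partial>\<mu>) \<le> (\<integral>x. f x \<partial>\<nu>))"

(* Measures on the product live on the Borel sets of the product topology, which may be strictly
   finer than the product of the Borel sigma-algebras. *)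
definition couplings ::
  "'a topology \<Rightarrow> ('a \<Rightarrow> real) set \<Rightarrow> 'a measure \<Rightarrow> 'a measure \<Rightarrow> ('a \<times> 'a) measure set" where
  "couplings T F \<mu> \<nu> =
     {\<pi>. radon_prob (prod_topology T T) \<pi> \<and>
         distr \<pi> (borel_of T) fst = \<mu> \<and>
         distr \<pi> (borel_of T) snd = \<nu> \<and>
         (\<forall>f\<in>F. \<forall>h\<in>borel_measurable (borel_of T).
            (\<forall>x. 0 \<le> h x) \<and> (\<exists>C. \<forall>x. h x \<le> C) \<longrightarrow>
            (\<integral>x. f x * h x \<partial>\<mu>) \<le> (\<integral>z. f (snd z) * h (fst z) \<partial>\<pi>))}"

end

theory Submission
  imports Defs
begin

text \<open>
  The set \<open>S\<close> is the intersection of all closed sets that carry every coupling, so it is closed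
  and minimal by construction; what has to be shown is that it still carries every coupling.
  The intersection may be uncountable, so countable additivity alone does not suffice. The Radon
  property does: the complement of \<open>S\<close> is a union of open null sets of a coupling \<open>\<pi>\<close>, each of
  its compact subsets is covered by finitely many of them and hence null, and inner regularity
  makes the complement itself null (\<open>radon_measure_null_Union_open\<close>). In other words,
  full closed sets of a Radon probability measure are stable under arbitrary intersections
  (\<open>radon_prob_full_Inter_closed\<close>). Since this concerns one measure at a time, it
  applies to all couplings simultaneously.
\<close>

lemma sets_borel_of_openin: "openin T U \<Longrightarrow> U \<in> sets (borel_of T)"
  unfolding borel_of_def by (subst sets_measure_of) (auto dest: openin_subset)

lemma space_borel_of: "space (borel_of T) = topspace T"
  unfolding borel_of_def by (rule space_measure_of) (auto dest: openin_subset)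

lemma radon_measure_openin_sets:
  assumes "radon_measure T M" and "openin T U"
  shows "U \<in> sets M"
  using assms by (simp add: radon_measure_def sets_borel_of_openin)

lemma radon_measure_closedin_sets:
  assumes "radon_measure T M" and "closedin T S"
  shows "S \<in> sets M"
proof -
  have "topspace T \<in> sets M" and "topspace T - S \<in> sets M"
    using assms by (auto intro: radon_measure_openin_sets)
  then have "topspace T - (topspace T - S) \<in> sets M"
    by (rule sets.Diff)
  then show ?thesis
    using closedin_subset[OF assms(2)] by (simp add: double_diff)
qed

lemma radon_measure_space:
  assumes "radon_measure T M"
  shows "space M = topspace T"
proof -
  have "sets M = sets (borel_of T)"
    using assms by (simp add: radon_measure_def)
  from sets_eq_imp_space_eq[OF this] show ?thesis
    by (simp add: space_borel_of)
qed

text \<open>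
  Compactness replaces the family by a finite subfamily, up to an error that inner regularity
  makes arbitrarily small.
\<close>
lemma radon_measure_null_Union_open:
  assumes M: "radon_measure T M"
    and opn: "\<And>U. U \<in> \<U> \<Longrightarrow> openin T U"
    and null: "\<And>U. U \<in> \<U> \<Longrightarrow> emeasure M U = 0"
  shows "emeasure M (\<Union>\<U>) = 0"
proof -
  have sets: "\<Union>\<U> \<in> sets M"
    using M opn by (blast intro: radon_measure_openin_sets)
  have "emeasure M (\<Union>\<U>) \<le> 0 + ennreal e" if "0 < e" for e
  proof -
    obtain K where K: "K \<in> sets M" "compactin T K" "K \<subseteq> \<Union>\<U>"
      and small: "emeasure M (\<Union>\<U> - K) < ennreal e"
      using M sets \<open>0 < e\<close> unfolding radon_measure_def by blast
    obtain \<V> where \<V>: "finite \<V>" "\<V> \<subseteq> \<U>" "K \<subseteq> \<Union>\<V>"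
      using compactinD[OF K(2) opn K(3)] by blast
    have "\<V> \<subseteq> null_sets M"
      using \<V>(2) opn null by (blast intro: null_setsI radon_measure_openin_sets[OF M])
    with \<V>(1) have "\<Union>\<V> \<in> null_sets M"
      by (rule null_sets.finite_Union)
    then have "emeasure M K = 0"
      using \<V>(3) K(1) by (meson null_sets_subset null_setsD1)
    then have "emeasure M (\<Union>\<U>) = emeasure M (\<Union>\<U> - K)"
      using sets K(1) by (simp add: emeasure_Diff_null_set null_setsI)
    then show ?thesis
      using small by simp
  qed
  then have "emeasure M (\<Union>\<U>) \<le> 0"
    by (rule ennreal_le_epsilon)
  then show ?thesis
    by simp
qed

lemma radon_prob_full_Inter_closed:
  assumes M: "radon_prob T M"
    and "\<C> \<noteq> {}"
    and clo: "\<And>S. S \<in> \<C> \<Longrightarrow> closedin T S"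
    and full: "\<And>S. S \<in> \<C> \<Longrightarrow> emeasure M S = 1"
  shows "emeasure M (\<Inter>\<C>) = 1"
proof -
  interpret prob_space M
    using M by (simp add: radon_prob_def)
  have rad: "radon_measure T M"
    using M by (simp add: radon_prob_def)
  have space: "space M = topspace T"
    by (rule radon_measure_space[OF rad])
  have "closedin T (\<Inter>\<C>)"
    using assms(2) clo by (rule closedin_Inter)
  then have Inter: "\<Inter>\<C> \<in> sets M"
    by (rule radon_measure_closedin_sets[OF rad])
  have "emeasure M (topspace T - S) = 0" if "S \<in> \<C>" for S
    using emeasure_compl[of S M] radon_measure_closedin_sets[OF rad clo[OF that]] full[OF that]
    by (simp add: emeasure_space_1 flip: space)
  then have "emeasure M (\<Union>S\<in>\<C>. topspace T - S) = 0"
    using clo by (intro radon_measure_null_Union_open[OF rad]) auto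
  then have "emeasure M (space M - \<Inter>\<C>) = 0"
    by (simp add: space Diff_Inter)
  then have "AE x in M. x \<in> \<Inter>\<C>"
    using Inter by (intro AE_I[of _ _ "space M - \<Inter>\<C>"]) auto
  then show ?thesis
    using Inter by (simp add: emeasure_eq_1_AE)
qed

theorem proposition8p1:
  fixes G :: "('a \<Rightarrow> real) set"
    and p :: "'a \<Rightarrow> real"
    and \<mu> \<nu> :: "'a measure"
  assumes "fun_convex_cone G"
    and "contains_constants G"
    and "separates_points G"
    and "\<forall>x. 0 \<le> p x"
    and "(\<lambda>x. ereal (p x)) \<in> complete_lattice_cone G"
    and "proper_fun (tau G) p"
    and "\<forall>g\<in>G. \<exists>C>0. \<forall>x. \<bar>g x\<bar> \<le> C * (p x + 1)"
    and "radon_prob (tau G) \<mu>"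
    and "radon_prob (tau G) \<nu>"
    and "integrable \<mu> p"
    and "integrable \<nu> p"
    and "order_le (lattice_cone G) \<mu> \<nu>"
  shows "\<exists>S. closedin (prod_topology (tau G) (tau G)) S \<and>
             (\<forall>\<pi>\<in>couplings (tau G) (lattice_cone G) \<mu> \<nu>. emeasure \<pi> S = 1) \<and>
             (\<forall>S'. closedin (prod_topology (tau G) (tau G)) S' \<and>
                   (\<forall>\<pi>\<in>couplings (tau G) (lattice_cone G) \<mu> \<nu>. emeasure \<pi> S' = 1)
                   \<longrightarrow> S \<subseteq> S')"
proof -
  let ?T = "prod_topology (tau G) (tau G)"
  let ?\<Gamma> = "couplings (tau G) (lattice_cone G) \<mu> \<nu>"
  define \<C> where "\<C> = {S. closedin ?T S \<and> (\<forall>\<pi>\<in>?\<Gamma>. emeasure \<pi> S = 1)}"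
  have radon: "radon_prob ?T \<pi>" if "\<pi> \<in> ?\<Gamma>" for \<pi>
    using that by (simp add: couplings_def)
  have "emeasure \<pi> (topspace ?T) = 1" if "\<pi> \<in> ?\<Gamma>" for \<pi>
    using radon[OF that] radon_measure_space[of ?T \<pi>] prob_space.emeasure_space_1[of \<pi>]
    unfolding radon_prob_def by metis
  then have "topspace ?T \<in> \<C>"
    unfolding \<C>_def by blast
  then have nonempty: "\<C> \<noteq> {}"
    by blast
  have "closedin ?T (\<Inter>\<C>)"
    using nonempty by (rule closedin_Inter) (simp add: \<C>_def)
  moreover have "emeasure \<pi> (\<Inter>\<C>) = 1" if "\<pi> \<in> ?\<Gamma>" for \<pi>
    using radon[OF that] nonempty
    by (rule radon_prob_full_Inter_closed) (use that in \<open>auto simp: \<C>_def\<close>)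
  moreover have "\<Inter>\<C> \<subseteq> S'" if "closedin ?T S' \<and> (\<forall>\<pi>\<in>?\<Gamma>. emeasure \<pi> S' = 1)" for S'
    using that by (auto simp: \<C>_def)
  ultimately show ?thesis
    by blast
qed

end
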